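(* Neither the word $12121122$ nor the word $21212211$ can be produced by any double rotation. That is, for all real $R$ with $0<R<1$ and all real $h_1,h_2$, there is no path $x_1,\dots,x_8\in[0,1)$ of the double rotation $f$ with parameters $R,h_1,h_2$ (meaning $x_{i+1}=f(x_i)$ for $i=1,\dots,7$) whose associated binary word is $12121122$ or $21212211$.
   Context: For real $R$ with $0<R<1$ and real $h_1,h_2$, the double rotation with parameters $R,h_1,h_2$ is the map $f:[0,1)\to[0,1)$ given by $f(x)=\{x+h_1\}$ if $x<R$ and $f(x)=\{x+h_2\}$ otherwise, where $\{y\}$ denotes the fractional part of $y$. To a path $x_1,\dots,x_n$ (with $x_{i+1}=f(x_i)$) one associates the binary word of length $n$ over the alphabet $\{1,2\}$ whose $i$-th digit is $1$ if $x_i<R$ and $2$ otherwise. *)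

theory Defs
  imports Complex_Main
begin

text \<open>The map is given on all of \<open>real\<close>; only its values on \<open>{0..<1}\<close> matter,
  and paths are required to lie there.\<close>

definition double_rotation :: "real \<Rightarrow> real \<Rightarrow> real \<Rightarrow> real \<Rightarrow> real" where
  "double_rotation R h1 h2 x = (if x < R then frac (x + h1) else frac (x + h2))"

definition is_path :: "real \<Rightarrow> real \<Rightarrow> real \<Rightarrow> real list \<Rightarrow> bool" where
  "is_path R h1 h2 xs \<longleftrightarrow>
     set xs \<subseteq> {0..<1} \<and>
     (\<forall>i. Suc i < length xs \<longrightarrow> xs ! Suc i = double_rotation R h1 h2 (xs ! i))"

definition path_word :: "real \<Rightarrow> real list \<Rightarrow> nat list" where
  "path_word R xs = map (\<lambda>x. if x < R then 1 else 2) xs"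

end

theory Submission
  imports Defs
begin

text \<open>
  Read all points on the circle of reals modulo 1, where \<open>{0..<R}\<close> and \<open>{R..<1}\<close> are two
  complementary arcs \<open>A\<close> and \<open>B\<close>. Put \<open>s = h1 + h2\<close>, let \<open>x\<close> be the first point of a path with
  word \<open>12121122\<close>, and let \<open>y\<close> be the second. As the position of a point depends only on how many
  1s and 2s precede it, the points at the places 1, 3, 5 are \<open>x\<close>, \<open>x + s\<close>, \<open>x + 2s\<close>, and those at
  the places 2, 4, 6, 8 are \<open>y\<close>, \<open>y + s\<close>, \<open>y + 2s\<close>, \<open>y + 3s\<close>. So the rotation by \<open>s\<close> has one orbit
  with three successive points in \<open>A\<close> and one whose points lie in \<open>B\<close>, \<open>B\<close>, \<open>A\<close>, \<open>B\<close>. The lemma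
  \<open>rotation_no_AAA_and_BBAB\<close> shows that a single rotation cannot do both. The other word exchanges
  the two arcs, and rotating the circle by \<open>-R\<close> takes it to the same lemma with \<open>1 - R\<close> for \<open>R\<close>.
\<close>

text \<open>
  Take \<open>s\<close> in \<open>{0..<1}\<close>. A point of \<open>A\<close> whose two neighbours in its orbit lie outside \<open>A\<close> makes
  \<open>A\<close> shorter than \<open>2s\<close> and than \<open>2(1 - s)\<close>. Three successive points in \<open>A\<close> then move by \<open>s\<close> in
  one step and by \<open>s - 1\<close> in the other, so \<open>A\<close> is longer than \<open>s\<close> and than \<open>1 - s\<close>. But if
  \<open>s \<le> 1/2\<close>, say, the points \<open>y + s\<close> and \<open>y + 1\<close> of \<open>B\<close> enclose the point \<open>y + 2s\<close> of \<open>A\<close>, which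
  confines \<open>A\<close> to an arc of length \<open>1 - s\<close>; if \<open>s \<ge> 1/2\<close>, the points \<open>y\<close> and \<open>y + s\<close> confine it
  to length \<open>s\<close> in the same way.
\<close>

lemma rotation_no_AAA_and_BBAB:
  fixes R s x y :: real
  assumes x: "frac x < R" "frac (x + s) < R" "frac (x + 2 * s) < R"
    and y: "R \<le> frac y" "R \<le> frac (y + s)" "frac (y + 2 * s) < R" "R \<le> frac (y + 3 * s)"
  shows False
proof -
  define \<sigma> where "\<sigma> = frac s"
  define z where "z = frac (y + 2 * s)"
  have \<sigma>: "0 \<le> \<sigma>" "\<sigma> < 1" and z: "0 \<le> z" "z < R"
    using y(3) by (simp_all add: \<sigma>_def z_def frac_lt_1)
  have step: "frac (t + s) = frac t + \<sigma> \<or> frac (t + s) = frac t + \<sigma> - 1" for t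
    by (simp add: frac_add \<sigma>_def)
  note range = frac_ge_0 frac_lt_1
  have x_steps: "frac (x + s) = frac x + \<sigma> \<or> frac (x + s) = frac x + \<sigma> - 1"
      "frac (x + 2 * s) = frac (x + s) + \<sigma> \<or> frac (x + 2 * s) = frac (x + s) + \<sigma> - 1"
    using step[of x] step[of "x + s"] by (simp_all add: algebra_simps)
  have y_step1: "frac (y + s) = frac y + \<sigma> \<or> frac (y + s) = frac y + \<sigma> - 1"
    and y_step2: "z = frac (y + s) + \<sigma> \<or> z = frac (y + s) + \<sigma> - 1"
    and y_step3: "frac (y + 3 * s) = z + \<sigma> \<or> frac (y + 3 * s) = z + \<sigma> - 1"
    using step[of y] step[of "y + s"] step[of "y + 2 * s"]
    by (simp_all add: z_def algebra_simps)
  \<comment> \<open>The orbit enters \<open>A\<close> across the end point 0 and leaves it across \<open>R\<close>.\<close>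
  have before: "frac (y + s) = z - \<sigma> + 1"
    using y_step2 y(2) z \<sigma> by linarith
  have after: "frac (y + 3 * s) = z + \<sigma>"
    using y_step3 y(4) z \<sigma> by linarith
  have short: "R < 2 * \<sigma> \<and> R < 2 * (1 - \<sigma>)"
    using before after y(2,4) range[of "y + s"] range[of "y + 3 * s"] by argo
  have long: "\<sigma> < R \<and> 1 - \<sigma> < R"
    using x_steps short x range[of x] range[of "x + s"] range[of "x + 2 * s"] by argo
  \<comment> \<open>The step from \<open>y\<close> to \<open>y + s\<close> wraps around exactly if \<open>\<sigma> > 1/2\<close>.\<close>
  from y_step1 show False
  proof
    assume "frac (y + s) = frac y + \<sigma>"
    then have "R \<le> z - 2 * \<sigma> + 1"
      using before y(1) by linarith
    moreover have "z < \<sigma>"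
      using before range[of "y + s"] by linarith
    ultimately show False
      using long by linarith
  next
    assume "frac (y + s) = frac y + \<sigma> - 1"
    then have "z - 2 * \<sigma> + 2 < 1"
      using before range[of y] by linarith
    moreover have "R \<le> z - \<sigma> + 1"
      using before y(2) by linarith
    ultimately show False
      using long by linarith
  qed
qed

lemma frac_diff_less_iff:
  fixes R t :: real
  assumes "0 < R" "R < 1"
  shows "frac (t - R) < 1 - R \<longleftrightarrow> R \<le> frac t"
proof -
  define f where "f = frac t"
  have f: "0 \<le> f" "f < 1"
    by (simp_all add: f_def frac_lt_1)
  have "t - R - (f - R) \<in> \<int>" "t - R - (f - R + 1) \<in> \<int>"
    by (simp_all add: f_def frac_def)
  then have "frac (t - R) = (if R \<le> f then f - R else f - R + 1)"
    using assms f by (simp add: frac_unique_iff)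
  then show ?thesis
    using f unfolding f_def[symmetric] by simp
qed

corollary rotation_no_BBB_and_AABA:
  fixes R s x y :: real
  assumes R: "0 < R" "R < 1"
    and x: "R \<le> frac x" "R \<le> frac (x + s)" "R \<le> frac (x + 2 * s)"
    and y: "frac y < R" "frac (y + s) < R" "R \<le> frac (y + 2 * s)" "frac (y + 3 * s) < R"
  shows False
proof (rule rotation_no_AAA_and_BBAB)
  have shift: "frac (t - R + u) < 1 - R \<longleftrightarrow> R \<le> frac (t + u)" for t u
    using frac_diff_less_iff[OF R, of "t + u"] by (simp add: algebra_simps)
  note shift0 = frac_diff_less_iff[OF R]
  show "frac (x - R) < 1 - R" "frac (x - R + s) < 1 - R" "frac (x - R + 2 * s) < 1 - R"
    using x by (simp_all add: shift shift0)
  show "1 - R \<le> frac (y - R)" "1 - R \<le> frac (y - R + s)" "frac (y - R + 2 * s) < 1 - R"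
      "1 - R \<le> frac (y - R + 3 * s)"
    using y by (simp_all add: shift shift0 flip: not_less)
qed

lemma frac_frac_add [simp]: "frac (frac x + y) = frac (x + y :: real)"
  by (simp add: frac_def algebra_simps)

theorem mainTheorem4:
  fixes R h1 h2 :: real
  assumes "0 < R" and "R < 1"
  shows "\<not> (\<exists>xs. length xs = 8 \<and> is_path R h1 h2 xs \<and>
           (path_word R xs = [1, 2, 1, 2, 1, 1, 2, 2] \<or>
            path_word R xs = [2, 1, 2, 1, 2, 2, 1, 1]))"
proof
  assume "\<exists>xs. length xs = 8 \<and> is_path R h1 h2 xs \<and>
           (path_word R xs = [1, 2, 1, 2, 1, 1, 2, 2] \<or>
            path_word R xs = [2, 1, 2, 1, 2, 2, 1, 1])"
  then obtain xs where len: "length xs = 8" and path: "is_path R h1 h2 xs"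
    and word: "path_word R xs = [1, 2, 1, 2, 1, 1, 2, 2] \<or>
               path_word R xs = [2, 1, 2, 1, 2, 2, 1, 1]"
    by blast
  obtain x1 x2 x3 x4 x5 x6 x7 x8 where xs: "xs = [x1, x2, x3, x4, x5, x6, x7, x8]"
    using len by (auto simp: length_Suc_conv eval_nat_numeral)
  have next_point: "xs ! Suc i = double_rotation R h1 h2 (xs ! i)" if "i < 7" for i
    using path that len by (simp add: is_path_def)
  have steps: "x2 = double_rotation R h1 h2 x1" "x3 = double_rotation R h1 h2 x2"
      "x4 = double_rotation R h1 h2 x3" "x5 = double_rotation R h1 h2 x4"
      "x6 = double_rotation R h1 h2 x5" "x7 = double_rotation R h1 h2 x6"
      "x8 = double_rotation R h1 h2 x7"
    using next_point[of 0] next_point[of 1] next_point[of 2] next_point[of 3]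
      next_point[of 4] next_point[of 5] next_point[of 6]
    by (simp_all add: xs eval_nat_numeral)
  have x1: "frac x1 = x1"
    using path by (simp add: is_path_def xs frac_eq)
  from word show False
  proof
    assume "path_word R xs = [1, 2, 1, 2, 1, 1, 2, 2]"
    then have A: "x1 < R" "x3 < R" "x5 < R" "x6 < R"
      and B: "R \<le> x2" "R \<le> x4" "R \<le> x8" and B7: "R \<le> x7"
      by (simp_all add: path_word_def xs split: if_splits)
    have x2: "x2 = frac (x1 + h1)"
      using steps(1) A by (simp add: double_rotation_def)
    have x3: "x3 = frac (x1 + (h1 + h2))"
      using steps(2) B by (simp add: double_rotation_def x2 algebra_simps)
    have x4: "x4 = frac (x1 + h1 + (h1 + h2))"
      using steps(3) A by (simp add: double_rotation_def x3 algebra_simps)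
    have x5: "x5 = frac (x1 + 2 * (h1 + h2))"
      using steps(4) B by (simp add: double_rotation_def x4 algebra_simps)
    have x6: "x6 = frac (x1 + h1 + 2 * (h1 + h2))"
      using steps(5) A by (simp add: double_rotation_def x5 algebra_simps)
    have x7: "x7 = frac (x1 + 2 * h1 + 2 * (h1 + h2))"
      using steps(6) A by (simp add: double_rotation_def x6 algebra_simps)
    have x8: "x8 = frac (x1 + h1 + 3 * (h1 + h2))"
      using steps(7) B7 by (simp add: double_rotation_def x7 algebra_simps)
    show False
      using rotation_no_AAA_and_BBAB[of x1 R "h1 + h2" "x1 + h1"] A B x1
      unfolding x2 x3 x4 x5 x6 x8 by simp
  next
    assume "path_word R xs = [2, 1, 2, 1, 2, 2, 1, 1]"
    then have B: "R \<le> x1" "R \<le> x3" "R \<le> x5" "R \<le> x6"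
      and A: "x2 < R" "x4 < R" "x8 < R" and A7: "x7 < R"
      by (simp_all add: path_word_def xs split: if_splits)
    have x2: "x2 = frac (x1 + h2)"
      using steps(1) B by (simp add: double_rotation_def)
    have x3: "x3 = frac (x1 + (h1 + h2))"
      using steps(2) A by (simp add: double_rotation_def x2 algebra_simps)
    have x4: "x4 = frac (x1 + h2 + (h1 + h2))"
      using steps(3) B by (simp add: double_rotation_def x3 algebra_simps)
    have x5: "x5 = frac (x1 + 2 * (h1 + h2))"
      using steps(4) A by (simp add: double_rotation_def x4 algebra_simps)
    have x6: "x6 = frac (x1 + h2 + 2 * (h1 + h2))"
      using steps(5) B by (simp add: double_rotation_def x5 algebra_simps)
    have x7: "x7 = frac (x1 + 2 * h2 + 2 * (h1 + h2))"
      using steps(6) B by (simp add: double_rotation_def x6 algebra_simps)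
    have x8: "x8 = frac (x1 + h2 + 3 * (h1 + h2))"
      using steps(7) A7 by (simp add: double_rotation_def x7 algebra_simps)
    show False
      using rotation_no_BBB_and_AABA[of R x1 "h1 + h2" "x1 + h2"] assms A B x1
      unfolding x2 x3 x4 x5 x6 x8 by simp
  qed
qed

end
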